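(* Let $G$ be a finite group. Then $G$ is nilpotent if and only if $\mathfrak{J}(G) = 1$.
   Context: For a finite group $G$, $\mathfrak{J}(G) = \mathrm{Nil}(G)/L(G)$, where $\mathrm{Nil}(G)$ is the number of nilpotent subgroups of $G$ and $L(G)$ is the total number of subgroups of $G$. In both counts the trivial subgroup and $G$ itself are among the subgroups considered. *)

theory Defs
  imports Complex_Main "HOL-Algebra.Generated_Groups"
begin

(* The commutator x g x^-1 g^-1 follows the convention of derived_set; the series is
   indexed from 0, so the n-th term here is the classical gamma_(n+1)(G). *)
primrec lower_central :: "('a, 'b) monoid_scheme \<Rightarrow> nat \<Rightarrow> 'a set" where
  "lower_central G 0 = carrier G"
| "lower_central G (Suc n) = generate G
     (\<Union>x \<in> lower_central G n. \<Union>g \<in> carrier G.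
        {x \<otimes>\<^bsub>G\<^esub> g \<otimes>\<^bsub>G\<^esub> inv\<^bsub>G\<^esub> x \<otimes>\<^bsub>G\<^esub> inv\<^bsub>G\<^esub> g})"

definition nilpotent_group :: "('a, 'b) monoid_scheme \<Rightarrow> bool" where
  "nilpotent_group G \<longleftrightarrow> group G \<and> (\<exists>n. lower_central G n = {\<one>\<^bsub>G\<^esub>})"

definition num_subgroups :: "('a, 'b) monoid_scheme \<Rightarrow> nat" where
  "num_subgroups G = card {H. subgroup H G}"

definition num_nilpotent_subgroups :: "('a, 'b) monoid_scheme \<Rightarrow> nat" where
  "num_nilpotent_subgroups G =
     card {H. subgroup H G \<and> nilpotent_group (G\<lparr>carrier := H\<rparr>)}"

definition nilpotent_ratio :: "('a, 'b) monoid_scheme \<Rightarrow> real" where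
  "nilpotent_ratio G = real (num_nilpotent_subgroups G) / real (num_subgroups G)"

end

theory Submission
  imports Defs
begin

text \<open>A finite group has finitely many subgroups and at least one, so the ratio is 1 exactly
  when every subgroup is nilpotent. That forces G to be nilpotent, since G is one of its own
  subgroups. Conversely, nilpotency passes to subgroups (\<open>nilpotent_group_subgroup\<close>):
  the lower central series of H lies term by term inside that of G
  (\<open>lower_central_subgroup_mono\<close>), so it is trivial as soon as that of G is.\<close>

lemma (in group) lower_central_incl: "lower_central G n \<subseteq> carrier G"
proof (induction n)
  case (Suc n)
  then show ?case
    by (simp, intro generate_incl) auto
qed simp

text \<open>Upgrades an inclusion of a term in the trivial subgroup to the equality that
  \<open>nilpotent_group\<close> asks for.\<close>

lemma (in group) one_in_lower_central: "\<one> \<in> lower_central G n"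
  by (cases n) (auto intro: generate.one)

text \<open>Induction on n: by the induction hypothesis, the commutators generating the next term
  for H are among those for G, and \<open>generate\<close> is monotone. The work lies in moving
  inverses and generated subgroups from H to G.\<close>

lemma (in group) lower_central_subgroup_mono:
  assumes "subgroup H G"
  shows "lower_central (G\<lparr>carrier := H\<rparr>) n \<subseteq> lower_central G n"
proof (induction n)
  case 0
  show ?case using subgroup.subset[OF assms] by simp
next
  case (Suc n)
  let ?H = "G\<lparr>carrier := H\<rparr>"
  let ?C = "\<lambda>A B. \<Union>x\<in>A. \<Union>g\<in>B. {x \<otimes> g \<otimes> inv x \<otimes> inv g}"
  interpret H: group ?H
    using assms is_group by (rule subgroup.subgroup_is_group)
  have sub: "lower_central ?H n \<subseteq> H"
    using H.lower_central_incl by simp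
  \<comment> \<open>The inverse depends on the carrier; the inverses in \<open>?H\<close> and G are
    known to agree on elements of H, hence the appeal to \<open>sub\<close>.\<close>
  have comm: "(\<Union>x\<in>lower_central ?H n. \<Union>g\<in>H.
      {x \<otimes>\<^bsub>?H\<^esub> g \<otimes>\<^bsub>?H\<^esub> inv\<^bsub>?H\<^esub> x \<otimes>\<^bsub>?H\<^esub> inv\<^bsub>?H\<^esub> g}) = ?C (lower_central ?H n) H"
    by (intro SUP_cong refl) (use sub in \<open>simp add: m_inv_consistent[OF assms] subset_iff\<close>)
  \<comment> \<open>For a generating set inside H, \<open>generate\<close> gives the same result in
    \<open>?H\<close> and in G.\<close>
  have "?C (lower_central ?H n) H \<subseteq> H"
    using sub by (auto simp: subset_iff subgroup.m_closed[OF assms] subgroup.m_inv_closed[OF assms])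
  then have "lower_central ?H (Suc n) = generate G (?C (lower_central ?H n) H)"
    using comm generate_consistent[OF _ assms] by simp
  also have "\<dots> \<subseteq> generate G (?C (lower_central G n) (carrier G))"
    using Suc.IH subgroup.subset[OF assms] by (intro mono_generate) blast
  finally show ?case by simp
qed

lemma nilpotent_group_subgroup:
  assumes "nilpotent_group G" "subgroup H G"
  shows "nilpotent_group (G\<lparr>carrier := H\<rparr>)"
proof -
  interpret G: group G
    using assms(1) by (simp add: nilpotent_group_def)
  interpret H: group "G\<lparr>carrier := H\<rparr>"
    using assms(2) G.is_group by (rule subgroup.subgroup_is_group)
  obtain n where "lower_central G n = {\<one>\<^bsub>G\<^esub>}"
    using assms(1) by (auto simp: nilpotent_group_def)
  then have "lower_central (G\<lparr>carrier := H\<rparr>) n = {\<one>\<^bsub>G\<^esub>}"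
    using G.lower_central_subgroup_mono[OF assms(2), of n] H.one_in_lower_central[of n] by auto
  then show ?thesis
    using H.is_group by (auto simp: nilpotent_group_def)
qed

theorem proposition2p1:
  fixes G :: "('a, 'b) monoid_scheme"
  assumes "group G" and "finite (carrier G)"
  shows "nilpotent_group G \<longleftrightarrow> nilpotent_ratio G = 1"
proof -
  interpret group G by fact
  let ?S = "{H. subgroup H G}"
  let ?N = "{H. subgroup H G \<and> nilpotent_group (G\<lparr>carrier := H\<rparr>)}"
  have fin: "finite ?S"
    by (rule finite_subset[of _ "Pow (carrier G)"]) (auto simp: assms dest: subgroup.subset)
  have "carrier G \<in> ?S"
    by (simp add: subgroup_self)
  \<comment> \<open>Division by 0 yields 0, so equal counts give ratio 1 only when the denominator
    is nonzero.\<close>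
  then have pos: "card ?S \<noteq> 0"
    using fin by auto
  have "nilpotent_ratio G = 1 \<longleftrightarrow> card ?N = card ?S"
    using pos by (auto simp: nilpotent_ratio_def num_subgroups_def num_nilpotent_subgroups_def)
  \<comment> \<open>A subset of a finite set with the same cardinality is the whole set.\<close>
  also have "\<dots> \<longleftrightarrow> ?N = ?S"
    using card_subset_eq[OF fin, of ?N] by auto
  also have "\<dots> \<longleftrightarrow> nilpotent_group G"
  proof
    assume "?N = ?S"
    then have "nilpotent_group (G\<lparr>carrier := carrier G\<rparr>)"
      using subgroup_self by blast
    then show "nilpotent_group G" by simp
  next
    assume "nilpotent_group G"
    then show "?N = ?S"
      using nilpotent_group_subgroup by blast
  qed
  finally show ?thesis by simp
qed

end
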